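(* Let $m=2$ and assume that $\Delta^2$ is indefinite. If $h>0$, then for every $\beta>0$ the system $$q_s=\mathbb E\tanh^2\big(\beta\eta\sqrt{(\Delta^2\Lambda\mathbf q)_s}+h\big),\qquad s=1,2,\qquad \eta\sim N(0,1),$$ has a unique solution $\mathbf q=(q_1,q_2)^{\top}\in[0,1]^2$.
   Context: $\Delta^2=\begin{pmatrix}a&b\\ c&d\end{pmatrix}$ is a symmetric, invertible $2\times2$ real matrix with non-negative entries (so $b=c$); indefinite means it has one positive and one negative eigenvalue. $\Lambda=\mathrm{diag}(\lambda_1,\lambda_2)$ with $\lambda_1,\lambda_2\in(0,1)$, $\lambda_1+\lambda_2=1$. *)

theory Defs
  imports "HOL-Probability.Probability"
begin

definition eigenvalue_of :: "real^'n^'n \<Rightarrow> real \<Rightarrow> bool" where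
  "eigenvalue_of A \<mu> \<longleftrightarrow> (\<exists>v. v \<noteq> 0 \<and> A *v v = \<mu> *s v)"

(* Intended for symmetric matrices of size 2, where having one positive and one
   negative eigenvalue accounts for the whole spectrum. *)
definition indefinite :: "real^2^2 \<Rightarrow> bool" where
  "indefinite A \<longleftrightarrow>
     (\<exists>\<mu>. \<mu> > 0 \<and> eigenvalue_of A \<mu>) \<and> (\<exists>\<mu>. \<mu> < 0 \<and> eigenvalue_of A \<mu>)"

definition diag :: "real^'n \<Rightarrow> real^'n^'n" where
  "diag d = (\<chi> i j. if i = j then d $ i else 0)"

end

theory Submission
  imports Defs
begin

text \<open>
  Write \<open>f x\<close> for the mean of \<open>(tanh (\<beta> * \<eta> * sqrt x + h))\<^sup>2\<close> with \<open>\<eta>\<close> standard normal, and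
  \<open>N = \<Delta>\<^sup>2 \<Lambda>\<close>. The system says that \<open>q\<close> is the entrywise image of \<open>x = N q\<close> under \<open>f\<close>, so
  \<open>x\<close> is a fixed point of the map that applies \<open>f\<close> entrywise and then \<open>N\<close>. The function
  \<open>f\<close> need not be monotone (for large \<open>h\<close> the square of \<open>tanh\<close> is concave near \<open>h\<close>), but its
  elasticity \<open>x f'(x) / f x\<close> lies between \<open>-1\<close> and \<open>1\<close>, in the sense that \<open>x f x\<close> is strictly
  increasing and \<open>f x / x\<close> is strictly decreasing. In the coordinates \<open>ln x\<^sub>i\<close> with the supremum
  metric, applying \<open>f\<close> therefore strictly decreases distances, and a matrix with nonnegative entries
  and no zero row does not increase them. Hence there is at most one positive fixed point
  (\<open>log_contraction_fixpoint_unique\<close>). Existence is Brouwer's theorem on the unit cube.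

  Both monotonicity properties come from a change of variables and need no derivative of \<open>f\<close>.
  Put \<open>t = \<beta> * sqrt x\<close>, so that \<open>Y = h + t * \<eta>\<close> is normal with mean \<open>h\<close> and standard deviation
  \<open>t\<close>. The density of \<open>Y\<close>, multiplied by \<open>t\<close>, is proportional to
  \<open>exp (- (y - h)\<^sup>2 / (2 * t\<^sup>2))\<close>, which increases with \<open>t\<close> at every \<open>y\<close>; so even
  \<open>sqrt x * f x\<close> is increasing (\<open>gauss_tanh_sq_times_mono\<close>). On the other hand \<open>f x / t\<^sup>2\<close> is the mean of
  \<open>(tanh (t * U))\<^sup>2 / t\<^sup>2\<close>, where \<open>U = Y / t\<close> has variance one and mean \<open>h / t\<close>. When \<open>t\<close>
  increases, the integrand decreases at every value of \<open>U\<close>, and the mean \<open>h / t\<close> moves towards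
  \<open>0\<close>, which lowers the average of any even function that increases with \<open>\<bar>U\<bar>\<close>
  (\<open>gauss_tanh_sq_div_strict_antimono\<close>).
\<close>

section \<open>Gaussian averages\<close>

lemma integrable_normal_density_times_bounded:
  fixes g :: "real \<Rightarrow> real"
  assumes "0 < \<sigma>" and [measurable]: "g \<in> borel_measurable borel"
    and "\<And>u. \<bar>g u\<bar> \<le> B"
  shows "integrable lborel (\<lambda>u. normal_density \<mu> \<sigma> u * g u)"
proof (rule Bochner_Integration.integrable_bound)
  show "integrable lborel (\<lambda>u. B * normal_density \<mu> \<sigma> u)"
    using assms(1) by simp
  have "\<bar>g u\<bar> \<le> \<bar>B\<bar>" for u
    using assms(3)[of u] by linarith
  then show "AE u in lborel. norm (normal_density \<mu> \<sigma> u * g u) \<le> norm (B * normal_density \<mu> \<sigma> u)"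
    by (auto simp: abs_mult mult.commute[of B] intro!: mult_left_mono)
qed measurable

lemma normal_density_unit_mono:
  assumes "\<bar>u - \<mu>\<bar> \<le> \<bar>v - \<nu>\<bar>"
  shows "normal_density \<nu> 1 v \<le> normal_density \<mu> 1 u"
proof -
  have "(u - \<mu>)\<^sup>2 \<le> (v - \<nu>)\<^sup>2"
    using assms by (simp add: abs_le_square_iff)
  then show ?thesis
    by (simp add: normal_density_def divide_right_mono)
qed

lemma lborel_integral_strict_mono_AE:
  fixes f g :: "real \<Rightarrow> real"
  assumes "integrable lborel f" "integrable lborel g" "AE u in lborel. f u < g u"
  shows "(\<integral>u. f u \<partial>lborel) < (\<integral>u. g u \<partial>lborel)"
proof -
  have "(\<integral>u. g u - f u \<partial>lborel) \<noteq> 0"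
  proof
    assume "(\<integral>u. g u - f u \<partial>lborel) = 0"
    moreover have "AE u in lborel. 0 \<le> g u - f u"
      using assms(3) by eventually_elim simp
    ultimately have "AE u in lborel. g u - f u = 0"
      using integral_nonneg_eq_0_iff_AE[of lborel "\<lambda>u. g u - f u"] assms(1,2) by blast
    with assms(3) have "AE u in (lborel :: real measure). False"
      by eventually_elim simp
    then show False
      by (simp add: eventually_False ae_filter_eq_bot_iff)
  qed
  moreover have "(\<integral>u. f u \<partial>lborel) \<le> (\<integral>u. g u \<partial>lborel)"
    using assms by (intro integral_mono_AE) auto
  ultimately show ?thesis
    using assms by simp
qed

text \<open>
  A one-dimensional form of Anderson's inequality. The difference of the two densities is odd under the
  reflection \<open>u \<mapsto> m + m' - u\<close>, so twice the difference of the averages is the integral of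
  the density difference times \<open>W u - W (m + m' - u)\<close>. Right of the midpoint the density with
  mean \<open>m'\<close> is the larger one and \<open>u\<close> is farther from \<open>0\<close> than its reflection; left of it both
  comparisons are reversed. The product is thus nonnegative everywhere.
\<close>
lemma normal_average_mono_mean:
  fixes W :: "real \<Rightarrow> real"
  assumes [measurable]: "W \<in> borel_measurable borel"
    and bound: "\<And>u. \<bar>W u\<bar> \<le> B"
    and mono: "\<And>u v. \<bar>u\<bar> \<le> \<bar>v\<bar> \<Longrightarrow> W u \<le> W v"
    and "0 \<le> m" "m \<le> m'"
  shows "(\<integral>u. normal_density m 1 u * W u \<partial>lborel) \<le> (\<integral>u. normal_density m' 1 u * W u \<partial>lborel)"
proof -
  define d where "d = (\<lambda>u. normal_density m' 1 u - normal_density m 1 u)"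
  have int: "integrable lborel (\<lambda>u. normal_density \<mu> 1 u * W u)" for \<mu>
    by (rule integrable_normal_density_times_bounded) (use bound in auto)
  have int': "integrable lborel (\<lambda>u. normal_density \<mu> 1 u * W (m + m' - u))" for \<mu>
    by (rule integrable_normal_density_times_bounded) (use bound in auto)
  have "normal_density m' 1 (m + m' - u) = normal_density m 1 u"
    "normal_density m 1 (m + m' - u) = normal_density m' 1 u" for u
    by (simp_all add: normal_density_def power2_commute)
  then have refl: "d (m + m' - u) = - d u" for u
    by (simp add: d_def)
  have dW: "integrable lborel (\<lambda>u. d u * W u)" "integrable lborel (\<lambda>u. d u * W (m + m' - u))"
    using int int' by (simp_all add: d_def left_diff_distrib)
  have "(\<integral>u. d u * W u \<partial>lborel) = (\<integral>u. d (m + m' - u) * W (m + m' - u) \<partial>lborel)"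
    using lborel_integral_real_affine[of "-1" "\<lambda>u. d u * W u" "m + m'"] by simp
  also have "\<dots> = - (\<integral>u. d u * W (m + m' - u) \<partial>lborel)"
    by (simp add: refl)
  finally have "2 * (\<integral>u. d u * W u \<partial>lborel) = (\<integral>u. d u * (W u - W (m + m' - u)) \<partial>lborel)"
    using dW by (simp add: right_diff_distrib)
  also have "\<dots> \<ge> 0"
  proof (rule integral_nonneg_AE, rule AE_I2)
    fix u
    show "0 \<le> d u * (W u - W (m + m' - u))"
    proof (cases "m + m' \<le> 2 * u")
      case True
      have "W (m + m' - u) \<le> W u" "normal_density m 1 u \<le> normal_density m' 1 u"
        by (rule mono normal_density_unit_mono, use True assms in linarith)+
      then show ?thesis
        by (simp add: d_def)
    next
      case False
      have "W u \<le> W (m + m' - u)" "normal_density m' 1 u \<le> normal_density m 1 u"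
        by (rule mono normal_density_unit_mono, use False assms in linarith)+
      then show ?thesis
        by (simp add: d_def mult_nonpos_nonpos)
    qed
  qed
  finally show ?thesis
    using int by (simp add: d_def left_diff_distrib)
qed

section \<open>The mean squared hyperbolic tangent of a Gaussian\<close>

text \<open>
  The scale \<open>t\<close> is the parameter, rather than the variance, because both changes of variables
  below are linear in it.
\<close>
definition gauss_tanh_sq :: "real \<Rightarrow> real \<Rightarrow> real" where
  "gauss_tanh_sq h t = (\<integral>z. std_normal_density z * (tanh (h + t * z))\<^sup>2 \<partial>lborel)"

lemma tanh_sq_le_1: "(tanh x)\<^sup>2 \<le> (1::real)"
  using tanh_real_bounds[of x] by (auto simp: abs_square_le_1)

lemma borel_measurable_tanh_real [measurable]: "(tanh :: real \<Rightarrow> real) \<in> borel_measurable borel"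
  by (rule borel_measurable_continuous_onI) (intro continuous_intros, simp)

lemma integrable_normal_tanh_sq:
  assumes "0 < \<sigma>"
  shows "integrable lborel (\<lambda>u. normal_density \<mu> \<sigma> u * (tanh (h + t * u))\<^sup>2)"
  by (rule integrable_normal_density_times_bounded[where B = 1]) (use assms tanh_sq_le_1 in auto)

lemma gauss_tanh_sq_le_1: "gauss_tanh_sq h t \<le> 1"
proof -
  have "gauss_tanh_sq h t \<le> (\<integral>z. std_normal_density z \<partial>lborel)"
    unfolding gauss_tanh_sq_def
    using tanh_sq_le_1 integrable_normal_tanh_sq[of 1]
    by (intro integral_mono) (auto intro!: mult_left_le)
  then show ?thesis by simp
qed

lemma gauss_tanh_sq_pos:
  assumes "h \<noteq> 0"
  shows "0 < gauss_tanh_sq h t"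
proof -
  have "AE z in lborel. h + t * z \<noteq> 0"
    using AE_lborel_singleton[of "- h / t"]
  proof eventually_elim
    case (elim z)
    then show ?case
      using assms by (cases "t = 0") (auto simp: field_simps add_eq_0_iff)
  qed
  then have "AE z in lborel. 0 < std_normal_density z * (tanh (h + t * z))\<^sup>2"
    by eventually_elim (simp add: normal_density_pos)
  then have "integral\<^sup>L lborel (\<lambda>z::real. 0) < gauss_tanh_sq h t"
    unfolding gauss_tanh_sq_def using integrable_normal_tanh_sq[of 1]
    by (intro lborel_integral_strict_mono_AE) auto
  then show ?thesis by simp
qed

lemma continuous_on_gauss_tanh_sq: "continuous_on S (gauss_tanh_sq h)"
  unfolding continuous_on_sequentially
proof (intro ballI allI impI, elim conjE)
  fix t :: "nat \<Rightarrow> real" and t0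
  assume lim: "t \<longlonglongrightarrow> t0"
  have "(\<lambda>n. gauss_tanh_sq h (t n)) \<longlonglongrightarrow> gauss_tanh_sq h t0"
    unfolding gauss_tanh_sq_def
  proof (rule integral_dominated_convergence[where w = std_normal_density])
    show "AE z in lborel. (\<lambda>n. std_normal_density z * (tanh (h + t n * z))\<^sup>2)
            \<longlonglongrightarrow> std_normal_density z * (tanh (h + t0 * z))\<^sup>2"
      by (intro AE_I2 tendsto_intros lim) simp
  qed (use tanh_sq_le_1 in \<open>auto simp: abs_mult intro!: mult_left_le\<close>)
  then show "(gauss_tanh_sq h \<circ> t) \<longlonglongrightarrow> gauss_tanh_sq h t0"
    by (simp add: comp_def)
qed

text \<open>
  Substituting \<open>y = h + t * z\<close> moves the whole dependence on \<open>t\<close> into the Gaussian factor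
  \<open>exp (- ((y - h) / t)\<^sup>2 / 2)\<close>, which increases with \<open>t\<close>.
\<close>
lemma gauss_tanh_sq_times_mono:
  assumes "0 < s" "s \<le> t"
  shows "s * gauss_tanh_sq h s \<le> t * gauss_tanh_sq h t"
proof -
  define k where "k = (\<lambda>r y. std_normal_density ((y - h) / r) * (tanh y)\<^sup>2)"
  have eq: "r * gauss_tanh_sq h r = (\<integral>y. k r y \<partial>lborel)" if "0 < r" for r
    using that lborel_integral_real_affine[of r "k r" h]
    by (simp add: gauss_tanh_sq_def k_def)
  have int: "integrable lborel (k r)" if "0 < r" for r
    using that integrable_normal_tanh_sq[of 1 0 h r]
      lborel_integrable_real_affine_iff[of r "k r" h]
    by (simp add: k_def)
  have "k s y \<le> k t y" for y
    unfolding k_def using assms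
    by (intro mult_right_mono normal_density_unit_mono) (auto simp: abs_divide intro!: divide_left_mono)
  then have "(\<integral>y. k s y \<partial>lborel) \<le> (\<integral>y. k t y \<partial>lborel)"
    using assms by (intro integral_mono int) auto
  then show ?thesis
    using assms by (simp add: eq)
qed

text \<open>
  This is the strict concavity of \<open>tanh\<close> on the positive half-line: the chord from \<open>v\<close> to \<open>w\<close> is
  less steep than the chord from \<open>0\<close> to \<open>v\<close>, because by the mean value theorem both slopes are
  values of the decreasing function \<open>1 - (tanh x)\<^sup>2\<close>.
\<close>
lemma tanh_div_strict_antimono:
  fixes v w :: real
  assumes "0 < v" "v < w"
  shows "tanh w * v < tanh v * w"
proof -
  have der: "(tanh has_real_derivative 1 - (tanh x)\<^sup>2) (at x)" for x :: real
    by (rule derivative_eq_intros | simp)+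
  obtain c where c: "v < c" "tanh w - tanh v = (w - v) * (1 - (tanh c)\<^sup>2)"
    using MVT2[OF assms(2) der] by blast
  obtain e where e: "0 < e" "e < v" "tanh v = v * (1 - (tanh e)\<^sup>2)"
    using MVT2[OF assms(1) der] by force
  have sq: "(tanh x)\<^sup>2 < (tanh y)\<^sup>2" if "0 < x" "x < y" for x y :: real
    using that by (intro power_strict_mono) auto
  have "(tanh w - tanh v) * v = (w - v) * (v * (1 - (tanh c)\<^sup>2))"
    using c(2) by simp
  also have "\<dots> < (w - v) * tanh v"
    unfolding e(3) using assms sq[of e c] e c by (intro mult_strict_left_mono) auto
  finally show ?thesis
    by (simp add: algebra_simps)
qed

lemma tanh_sq_scaling:
  fixes s t u :: real
  assumes "0 < s" "s < t" "u \<noteq> 0"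
  shows "(tanh (t * u))\<^sup>2 * s\<^sup>2 < (tanh (s * u))\<^sup>2 * t\<^sup>2"
proof -
  have "tanh (t * \<bar>u\<bar>) * (s * \<bar>u\<bar>) < tanh (s * \<bar>u\<bar>) * (t * \<bar>u\<bar>)"
    using assms by (intro tanh_div_strict_antimono) auto
  then have "tanh (t * \<bar>u\<bar>) * s < tanh (s * \<bar>u\<bar>) * t"
    using assms by (simp add: mult.assoc[symmetric])
  then have "(tanh (t * \<bar>u\<bar>) * s)\<^sup>2 < (tanh (s * \<bar>u\<bar>) * t)\<^sup>2"
    using assms by (intro power_strict_mono) auto
  moreover have "(tanh (r * \<bar>u\<bar>))\<^sup>2 = (tanh (r * u))\<^sup>2" for r
    by (cases "u \<ge> 0") auto
  ultimately show ?thesis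
    by (simp add: power_mult_distrib)
qed

text \<open>
  Known as the Latala--Guerra lemma. In the variable \<open>u = z + h / t\<close> the
  function becomes an average of \<open>(tanh (t * u))\<^sup>2\<close> over a unit-variance normal law with mean
  \<open>h / t\<close>. The scale and the mean are then changed one after the other: the scale by
  \<open>tanh_sq_scaling\<close>, which holds for each \<open>u\<close> and gives strictness, the mean by
  \<open>normal_average_mono_mean\<close>.
\<close>
lemma gauss_tanh_sq_div_strict_antimono:
  assumes "0 \<le> h" "0 < s" "s < t"
  shows "gauss_tanh_sq h t * s\<^sup>2 < gauss_tanh_sq h s * t\<^sup>2"
proof -
  define A where "A = (\<lambda>r m. \<integral>u. normal_density m 1 u * (tanh (r * u))\<^sup>2 \<partial>lborel)"
  have eq: "gauss_tanh_sq h r = A r (h / r)" if "0 < r" for r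
    using that lborel_integral_real_affine[of 1 "\<lambda>u. normal_density (h / r) 1 u * (tanh (r * u))\<^sup>2" "h / r"]
    by (simp add: gauss_tanh_sq_def A_def normal_density_def distrib_left)
  have int: "integrable lborel (\<lambda>u. normal_density m 1 u * (tanh (r * u))\<^sup>2)" for r m
    using integrable_normal_tanh_sq[of 1 m 0 r] by simp
  have "A t (h / t) * s\<^sup>2 < A s (h / t) * t\<^sup>2"
  proof -
    have "AE u in lborel. normal_density (h / t) 1 u * (tanh (t * u))\<^sup>2 * s\<^sup>2
            < normal_density (h / t) 1 u * (tanh (s * u))\<^sup>2 * t\<^sup>2"
      using AE_lborel_singleton[of 0]
    proof eventually_elim
      case (elim u)
      then show ?case
        using tanh_sq_scaling[OF assms(2,3), of u]
        by (simp add: mult.assoc normal_density_pos)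
    qed
    then have "(\<integral>u. normal_density (h / t) 1 u * (tanh (t * u))\<^sup>2 * s\<^sup>2 \<partial>lborel)
        < (\<integral>u. normal_density (h / t) 1 u * (tanh (s * u))\<^sup>2 * t\<^sup>2 \<partial>lborel)"
      by (intro lborel_integral_strict_mono_AE integrable_mult_left int) auto
    then show ?thesis
      by (simp add: A_def)
  qed
  also have "A s (h / t) \<le> A s (h / s)"
    unfolding A_def
  proof (rule normal_average_mono_mean[where B = 1])
    fix u v :: real
    assume "\<bar>u\<bar> \<le> \<bar>v\<bar>"
    then have "\<bar>tanh (s * u)\<bar> \<le> \<bar>tanh (s * v)\<bar>"
      using assms by (simp add: tanh_real_abs[symmetric] abs_mult del: tanh_real_abs)
    then show "(tanh (s * u))\<^sup>2 \<le> (tanh (s * v))\<^sup>2"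
      by (simp add: abs_le_square_iff)
  qed (use assms tanh_sq_le_1 in \<open>auto intro: divide_left_mono\<close>)
  then have "A s (h / t) * t\<^sup>2 \<le> A s (h / s) * t\<^sup>2"
    by (rule mult_right_mono) simp
  finally show ?thesis
    using assms by (simp add: eq)
qed

section \<open>Contraction in the logarithmic supremum metric\<close>

text \<open>
  Let \<open>r\<close> be the largest ratio, in either direction, of corresponding entries of \<open>x\<close> and
  \<open>y\<close>; its logarithm is their distance. If \<open>r > 1\<close>, the two monotonicity assumptions
  bound the corresponding ratios after applying \<open>f\<close> strictly below \<open>r\<close>, and this survives taking
  nonnegative combinations. Since \<open>x\<close> and \<open>y\<close> are fixed, their own ratios would all be smaller
  than \<open>r\<close>.
\<close>
lemma log_contraction_fixpoint_unique:
  fixes f :: "real \<Rightarrow> real" and N :: "real^'n^'n" and x y :: "real^'n"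
  assumes pos: "\<And>a. 0 < a \<Longrightarrow> 0 < f a"
    and up: "\<And>a b. 0 < a \<Longrightarrow> a < b \<Longrightarrow> f a * a < f b * b"
    and down: "\<And>a b. 0 < a \<Longrightarrow> a < b \<Longrightarrow> f b * a < f a * b"
    and N: "\<And>i j. 0 \<le> N $ i $ j" "\<And>i. \<exists>j. 0 < N $ i $ j"
    and x: "\<And>i. 0 < x $ i" "x = N *v (\<chi> j. f (x $ j))"
    and y: "\<And>i. 0 < y $ i" "y = N *v (\<chi> j. f (y $ j))"
  shows "x = y"
proof -
  have f_less: "f a < r * f b" if "0 < a" "0 < b" "1 < r" "a \<le> r * b" "b \<le> r * a" for a b r
  proof (cases a b rule: linorder_cases)
    case less
    have "f a * a < f b * b" by (rule up[OF that(1) less])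
    also have "\<dots> \<le> f b * (r * a)" using that pos[of b] by (intro mult_left_mono) auto
    finally have "f a * a < (r * f b) * a" by (simp add: mult_ac)
    then show ?thesis using that by (simp only: mult_less_cancel_right_pos)
  next
    case equal
    then show ?thesis using that pos[of b] by simp
  next
    case greater
    have "f a * b < f b * a" by (rule down[OF that(2) greater])
    also have "\<dots> \<le> f b * (r * b)" using that pos[of b] by (intro mult_left_mono) auto
    finally have "f a * b < (r * f b) * b" by (simp add: mult_ac)
    then show ?thesis using that by (simp only: mult_less_cancel_right_pos)
  qed
  have contract: "v $ i < r * w $ i"
    if v: "\<And>i. 0 < v $ i" "v = N *v (\<chi> j. f (v $ j))"
    and w: "\<And>i. 0 < w $ i" "w = N *v (\<chi> j. f (w $ j))"
    and "1 < r" "\<And>i. v $ i \<le> r * w $ i" "\<And>i. w $ i \<le> r * v $ i"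
    for v w :: "real^'n" and r i
  proof -
    obtain j0 where "0 < N $ i $ j0" using N(2) by blast
    have less: "f (v $ j) < r * f (w $ j)" for j
      by (rule f_less) (use that in auto)
    have "v $ i = (\<Sum>j\<in>UNIV. N $ i $ j * f (v $ j))"
      by (subst v(2)) (simp add: matrix_vector_mult_def)
    also have "\<dots> < (\<Sum>j\<in>UNIV. N $ i $ j * (r * f (w $ j)))"
    proof (rule sum_strict_mono_ex1)
      show "\<forall>j\<in>UNIV. N $ i $ j * f (v $ j) \<le> N $ i $ j * (r * f (w $ j))"
        using N(1) less by (intro ballI mult_left_mono) (auto intro: less_imp_le)
      show "\<exists>j\<in>UNIV. N $ i $ j * f (v $ j) < N $ i $ j * (r * f (w $ j))"
        using less \<open>0 < N $ i $ j0\<close> by (intro bexI[of _ j0] mult_strict_left_mono) auto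
    qed simp
    also have "\<dots> = r * (\<Sum>j\<in>UNIV. N $ i $ j * f (w $ j))"
      by (simp add: sum_distrib_left mult_ac)
    also have "(\<Sum>j\<in>UNIV. N $ i $ j * f (w $ j)) = w $ i"
      by (subst (2) w(2)) (simp add: matrix_vector_mult_def)
    finally show ?thesis .
  qed
  define \<rho> where "\<rho> = (\<lambda>i. max (x $ i / y $ i) (y $ i / x $ i))"
  define r where "r = Max (range \<rho>)"
  have "r \<in> range \<rho>" unfolding r_def by (rule Max_in) auto
  then obtain i where i: "r = \<rho> i" by blast
  have "\<rho> j \<le> r" for j unfolding r_def by (rule Max_ge) auto
  then have bd: "x $ j \<le> r * y $ j" "y $ j \<le> r * x $ j" for j
    using x(1)[of j] y(1)[of j] by (auto simp: \<rho>_def divide_le_eq)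
  have "r \<le> 1"
  proof (rule ccontr)
    assume "\<not> r \<le> 1"
    then have "x $ i < r * y $ i" "y $ i < r * x $ i"
      using bd by (auto intro: contract[OF x y] contract[OF y x])
    then have "\<rho> i < r"
      using x(1)[of i] y(1)[of i] by (simp add: \<rho>_def divide_less_eq)
    with i show False by simp
  qed
  have "r * x $ j \<le> x $ j" "r * y $ j \<le> y $ j" for j
    using \<open>r \<le> 1\<close> x(1)[of j] y(1)[of j] by (auto intro: mult_left_le_one_le simp: mult_le_cancel_right1)
  then have "x $ j = y $ j" for j
    using bd[of j] by (meson order.antisym order.trans)
  then show ?thesis by (simp add: vec_eq_iff)
qed

section \<open>The replica symmetric system\<close>

text \<open>
  Uniqueness is proved for \<open>N *v q\<close>, which is positive in every entry because \<open>q\<close>, being a value of a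
  positive function, is; the logarithmic metric makes sense only there.
\<close>
lemma gauss_tanh_sq_sqrt_system:
  fixes N :: "real^'n^'n"
  assumes N: "\<And>i j. 0 \<le> N $ i $ j" "\<And>i. \<exists>j. 0 < N $ i $ j"
    and "0 < h" "0 < \<beta>"
  shows "\<exists>!q :: real^'n. (\<forall>s. q $ s \<in> {0..1}) \<and>
           (\<forall>s. q $ s = gauss_tanh_sq h (\<beta> * sqrt ((N *v q) $ s)))"
proof -
  define f where "f = (\<lambda>a. gauss_tanh_sq h (\<beta> * sqrt a))"
  have f_pos: "0 < f a" for a
    unfolding f_def using assms by (intro gauss_tanh_sq_pos) simp
  have f_le: "f a \<le> 1" for a
    unfolding f_def by (rule gauss_tanh_sq_le_1)
  have up: "f a * a < f b * b" if "0 < a" "a < b" for a b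
  proof -
    have "(\<beta> * sqrt a) * f a \<le> (\<beta> * sqrt b) * f b"
      unfolding f_def using that assms by (intro gauss_tanh_sq_times_mono) auto
    then have "sqrt a * f a \<le> sqrt b * f b"
      using assms by (simp add: mult.assoc)
    then have "sqrt a * (sqrt a * f a) \<le> sqrt a * (sqrt b * f b)"
      using that by (intro mult_left_mono) auto
    also have "\<dots> < sqrt b * (sqrt b * f b)"
      using that f_pos[of b] by (intro mult_strict_right_mono) auto
    finally have "(sqrt a * sqrt a) * f a < (sqrt b * sqrt b) * f b"
      by (simp only: mult.assoc)
    then show ?thesis
      using that by (simp add: mult.commute)
  qed
  have down: "f b * a < f a * b" if "0 < a" "a < b" for a b
  proof -
    have "f b * (\<beta> * sqrt a)\<^sup>2 < f a * (\<beta> * sqrt b)\<^sup>2"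
      unfolding f_def using that assms by (intro gauss_tanh_sq_div_strict_antimono) auto
    then have "\<beta>\<^sup>2 * (f b * a) < \<beta>\<^sup>2 * (f a * b)"
      using that by (simp add: power_mult_distrib mult_ac)
    then show ?thesis
      using assms by simp
  qed
  have cube: "cbox 0 1 = {q :: real^'n. \<forall>s. q $ s \<in> {0..1}}"
    by (auto simp: mem_box_cart)
  have "cbox 0 (1 :: real^'n) \<noteq> {}"
    by (auto simp: cube intro: exI[of _ 0])
  moreover have "continuous_on (cbox 0 1) (\<lambda>q. \<chi> s. f ((N *v q) $ s))"
    unfolding f_def
    by (intro continuous_intros continuous_on_compose2[OF continuous_on_gauss_tanh_sq[of UNIV]]
        continuous_on_vec_lambda continuous_on_component matrix_vector_mult_linear_continuous_on) auto
  moreover have "(\<lambda>q. \<chi> s. f ((N *v q) $ s)) \<in> cbox 0 1 \<rightarrow> cbox 0 1"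
    using f_pos f_le by (auto simp: cube less_imp_le)
  ultimately obtain q where q: "q \<in> cbox 0 1" "(\<chi> s. f ((N *v q) $ s)) = q"
    by (rule brouwer[OF compact_cbox convex_box(1)])
  have fix_iff: "(\<forall>s. p $ s = f ((N *v p) $ s)) \<longleftrightarrow> (\<chi> s. f ((N *v p) $ s)) = p" for p
    by (auto simp: vec_eq_iff)
  have image: "0 < (N *v p) $ i" "N *v p = N *v (\<chi> j. f ((N *v p) $ j))"
    if "\<forall>s. p $ s = f ((N *v p) $ s)" for p i
  proof -
    obtain j0 where "0 < N $ i $ j0" using N(2) by blast
    moreover have "0 < p $ j" for j
      using that f_pos by metis
    ultimately have "0 < (\<Sum>j\<in>UNIV. N $ i $ j * p $ j)"
      using N(1) by (intro sum_pos2[of _ j0]) (auto intro: mult_nonneg_nonneg less_imp_le)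
    then show "0 < (N *v p) $ i"
      by (simp add: matrix_vector_mult_def)
    show "N *v p = N *v (\<chi> j. f ((N *v p) $ j))"
      using that fix_iff by simp
  qed
  show ?thesis
    unfolding f_def[symmetric]
  proof (rule ex1I[of _ q])
    show "(\<forall>s. q $ s \<in> {0..1}) \<and> (\<forall>s. q $ s = gauss_tanh_sq h (\<beta> * sqrt ((N *v q) $ s)))"
      using q fix_iff by (simp add: cube f_def)
  next
    fix p :: "real^'n"
    assume "(\<forall>s. p $ s \<in> {0..1}) \<and> (\<forall>s. p $ s = gauss_tanh_sq h (\<beta> * sqrt ((N *v p) $ s)))"
    then have p: "\<forall>s. p $ s = f ((N *v p) $ s)"
      by (simp add: f_def)
    have q': "\<forall>s. q $ s = f ((N *v q) $ s)"
      using q fix_iff by blast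
    have "N *v p = N *v q"
      by (rule log_contraction_fixpoint_unique[where f = f, OF f_pos up down N])
        (use image[OF p] image[OF q'] in auto)
    then show "p = q"
      using p q' by (simp add: vec_eq_iff)
  qed
qed

lemma invertible_row_nonzero:
  fixes A :: "real^'n^'n"
  assumes "invertible A"
  shows "\<exists>j. A $ i $ j \<noteq> 0"
proof (rule ccontr)
  assume "\<not> ?thesis"
  then have "row i A = 0"
    by (simp add: row_def vec_eq_iff)
  then show False
    using assms det_zero_row(1)[of i A] by (simp add: invertible_det_nz)
qed

lemma expectation_std_normal_tanh_sq:
  assumes "distributed M lborel \<eta> std_normal_density"
  shows "(\<integral>\<omega>. (tanh (h + t * \<eta> \<omega>))\<^sup>2 \<partial>M) = gauss_tanh_sq h t"
  unfolding gauss_tanh_sq_def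
  using distributed_integral[OF assms, of "\<lambda>z. (tanh (h + t * z))\<^sup>2"] by simp

theorem proposition1p6:
  fixes \<Delta>2 :: "real^2^2" and lam :: "real^2" and h \<beta> :: real
    and M :: "'w measure" and \<eta> :: "'w \<Rightarrow> real"
  assumes "transpose \<Delta>2 = \<Delta>2"
    and "invertible \<Delta>2"
    and "\<And>s t. \<Delta>2 $ s $ t \<ge> 0"
    and "indefinite \<Delta>2"
    and "\<And>s. 0 < lam $ s \<and> lam $ s < 1"
    and "lam $ 1 + lam $ 2 = 1"
    and "h > 0"
    and "\<beta> > 0"
    and "prob_space M"
    and "distributed M lborel \<eta> std_normal_density"
  shows "\<exists>!q :: real^2. (\<forall>s. q $ s \<in> {0..1}) \<and>
           (\<forall>s. q $ s = prob_space.expectation M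
              (\<lambda>\<omega>. (tanh (\<beta> * \<eta> \<omega> * sqrt (((\<Delta>2 ** diag lam) *v q) $ s) + h))\<^sup>2))"
proof -
  have entry: "(\<Delta>2 ** diag lam) $ i $ j = \<Delta>2 $ i $ j * lam $ j" for i j
    by (simp add: matrix_matrix_mult_def diag_def if_distrib cong: if_cong)
  have "\<exists>j. 0 < (\<Delta>2 ** diag lam) $ i $ j" for i
    using invertible_row_nonzero[OF assms(2), of i] assms(3,5) entry
    by (metis mult_pos_pos order_le_less)
  moreover have "0 \<le> (\<Delta>2 ** diag lam) $ i $ j" for i j
    using assms(3,5) by (simp add: entry less_imp_le)
  ultimately have "\<exists>!q :: real^2. (\<forall>s. q $ s \<in> {0..1}) \<and>
      (\<forall>s. q $ s = gauss_tanh_sq h (\<beta> * sqrt (((\<Delta>2 ** diag lam) *v q) $ s)))"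
    using assms(7,8) by (intro gauss_tanh_sq_sqrt_system)
  moreover have "(\<integral>\<omega>. (tanh (\<beta> * \<eta> \<omega> * r + h))\<^sup>2 \<partial>M) = gauss_tanh_sq h (\<beta> * r)" for r
    using expectation_std_normal_tanh_sq[OF assms(10), of h "\<beta> * r"]
    by (simp add: add.commute mult_ac)
  ultimately show ?thesis
    by simp
qed

end
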